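(* If a finite tree $T$ of order $n \ge 4$ has a redundant identifying code, then $\left\lceil \tfrac{4}{5}(n+1) \right\rceil \le \mathrm{RED{:}IC}(T) \le n$.
   Context: $N[v]$ denotes the closed neighborhood of $v$ and $\Delta$ symmetric difference. A set $S \subseteq V(T)$ is a redundant identifying code if every vertex $v$ satisfies $|N[v] \cap S| \ge 2$ and every pair of distinct vertices $u,v$ satisfies $|(N[u]\cap S)\,\Delta\,(N[v]\cap S)| \ge 2$; $\mathrm{RED{:}IC}(T)$ is the minimum cardinality of such a set. *)

theory Defs
  imports Complex_Main "Graph_Theory.Graph_Theory"
begin

(* A finite simple undirected graph is a pair_graph: every edge uv is stored as the two arcs
   (u,v) and (v,u). The library's forest (hence tree) is not usable for such graphs, since it
   counts the walk u,v,u along a single edge as a cycle. As there are no loops or parallel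
   arcs, the cycles of length at least 3 are exactly the cycles of the undirected graph.
   The constant connected is qualified because Complex_Main has a topological one. *)
definition undirected_tree :: "'a pair_pre_digraph \<Rightarrow> bool" where
  "undirected_tree G \<longleftrightarrow>
     pair_graph G \<and> Digraph_Component.connected (with_proj G) \<and>
     \<not> (\<exists>p. pre_digraph.cycle (with_proj G) p \<and> length p \<ge> 3)"

definition closed_nbhd :: "'a pair_pre_digraph \<Rightarrow> 'a \<Rightarrow> 'a set" where
  "closed_nbhd G v = insert v {w. (v, w) \<in> parcs G}"

definition redundant_identifying_code :: "'a pair_pre_digraph \<Rightarrow> 'a set \<Rightarrow> bool" where
  "redundant_identifying_code G S \<longleftrightarrow>
     S \<subseteq> pverts G \<and>
     (\<forall>v \<in> pverts G. card (closed_nbhd G v \<inter> S) \<ge> 2) \<and>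
     (\<forall>u \<in> pverts G. \<forall>v \<in> pverts G. u \<noteq> v \<longrightarrow>
        card (sym_diff (closed_nbhd G u \<inter> S) (closed_nbhd G v \<inter> S)) \<ge> 2)"

(* Unspecified if G has no redundant identifying code. *)
definition RED_IC :: "'a pair_pre_digraph \<Rightarrow> nat" where
  "RED_IC G = (LEAST k. \<exists>S. redundant_identifying_code G S \<and> card S = k)"

end

theory Submission
  imports Defs
begin

text \<open>
  Let \<open>S\<close> be a code with complement \<open>U\<close>, and root the tree at a vertex \<open>r\<close> of \<open>S\<close>.
  Call a vertex of \<open>S\<close> a top if its parent is not in \<open>S\<close>; the tops represent the components
  of the subgraph induced by \<open>S\<close>. A vertex of \<open>U\<close> has two neighbours in \<open>S\<close>, one of which is a
  child, hence a top; as \<open>r\<close> is a top too, there are at least \<open>|U| + 1\<close> tops. A top \<open>x\<close> has a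
  child \<open>y\<close> in \<open>S\<close>, and since the code separates \<open>x\<close> from \<open>y\<close>, there are two further vertices of
  \<open>S\<close> among the other children of \<open>x\<close> and the children of \<open>y\<close>. So each component has at least four
  vertices, which gives \<open>|S| \<ge> 4 (|U| + 1)\<close>, that is, \<open>5 |S| \<ge> 4 (n + 1)\<close>.
\<close>

text \<open>Encoding as a relation turns reachability after deletion of \<open>v\<close> into a
  reflexive transitive closure.\<close>

definition avoiding :: "'a pair_pre_digraph \<Rightarrow> 'a \<Rightarrow> 'a rel" where
  "avoiding G v = {(a, b) \<in> parcs G. a \<noteq> v \<and> b \<noteq> v}"

text \<open>The parent \<open>y\<close> of \<open>v\<close> in the tree rooted at \<open>r\<close>
  is the neighbour that stays connected to the root once \<open>v\<close> is deleted. The parent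
  comes before the child in the argument order.\<close>

definition parent :: "'a pair_pre_digraph \<Rightarrow> 'a \<Rightarrow> 'a \<Rightarrow> 'a \<Rightarrow> bool" where
  "parent G r y v \<longleftrightarrow> (y, v) \<in> parcs G \<and> v \<noteq> r \<and> (r, y) \<in> (avoiding G v)\<^sup>*"

context pair_graph
begin

lemma sym_avoiding: "sym (avoiding G v)"
  by (auto simp: avoiding_def intro!: symI dest: arcs_symmetric)

lemma avoiding_awalk:
  assumes "(u, w) \<in> (avoiding G v)\<^sup>*" "w \<in> pverts G" "w \<noteq> v"
  shows "\<exists>p. awalk u p w \<and> v \<notin> set (pawalk_verts u p)"
  using assms(1)
proof (induction rule: converse_rtrancl_induct)
  case base
  show ?case using assms(2,3) by (intro exI[of _ "[]"]) (simp add: awalk_Nil_iff)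
next
  case (step a b)
  then obtain p where p: "awalk b p w" "v \<notin> set (pawalk_verts b p)" by blast
  show ?case using step(1) p
    by (intro exI[of _ "(a, b) # p"]) (auto simp: awalk_Cons_iff avoiding_def)
qed

text \<open>A walk from \<open>u\<close> to \<open>w\<close> that misses \<open>v\<close> can be
  shortened to a path, and two arcs through \<open>v\<close> close it to a cycle.\<close>

lemma neighbours_avoiding_imp_cycle:
  assumes "(u, w) \<in> (avoiding G v)\<^sup>*" "(u, v) \<in> parcs G" "(w, v) \<in> parcs G" "u \<noteq> w"
  shows "\<exists>p. cycle p \<and> length p \<ge> 3"
proof -
  have "w \<in> pverts G" "w \<noteq> v"
    using assms(3) in_arcsD1 no_loops' by blast+
  then obtain p where p: "awalk u p w" "v \<notin> set (pawalk_verts u p)"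
    using avoiding_awalk assms(1) by blast
  define q where "q = awalk_to_apath p"
  have q: "apath u q w" unfolding q_def using p(1) by (rule apath_awalk_to_apath)
  have "set q \<subseteq> set p"
    unfolding q_def using p(1) by (rule awalk_to_apath_subset)
  then have "set (pawalk_verts u q) \<subseteq> set (pawalk_verts u p)"
    using set_awalk_verts[OF p(1)] set_awalk_verts[of u q w] q by (auto simp: apath_def)
  with p(2) have v: "v \<notin> set (pawalk_verts u q)" by blast
  have aw: "awalk u q w" and dist: "distinct (pawalk_verts u q)"
    using q by (auto simp: apath_def)
  have aw2: "awalk u (q @ [(w, v)]) v"
    using aw assms(3) in_arcsD2[OF assms(3)]
    by (auto simp: awalk_Cons_iff awalk_Nil_iff in_arcsD1)
  have "awalk v ((v, u) # q @ [(w, v)]) v"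
    using aw2 arcs_symmetric[OF assms(2)]
    by (simp only: awalk_Cons_iff fst_conv snd_conv simp_thms)
  moreover have "pawalk_verts u (q @ [(w, v)]) = pawalk_verts u q @ [v]"
    using awalk_verts_append[OF aw2] by simp
  then have "distinct (tl (pawalk_verts v ((v, u) # q @ [(w, v)])))"
    using dist v by simp
  ultimately have "cycle ((v, u) # q @ [(w, v)])"
    unfolding cycle_def by blast
  \<comment> \<open>Since \<open>u\<close> and \<open>w\<close> differ, the path has an arc, so the
    cycle is not a single edge walked back and forth.\<close>
  moreover have "q \<noteq> []" using aw assms(4) by (auto simp: awalk_Nil_iff)
  then have "length ((v, u) # q @ [(w, v)]) \<ge> 3" by (cases q) auto
  ultimately show ?thesis by blast
qed

text \<open>Two parents of \<open>v\<close> would be joined through the root by a walk that misses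
  \<open>v\<close>.\<close>

lemma parent_unique:
  assumes "\<nexists>p. cycle p \<and> length p \<ge> 3" "parent G r y v" "parent G r y' v"
  shows "y = y'"
proof (rule ccontr)
  assume neq: "y \<noteq> y'"
  have "(y, r) \<in> (avoiding G v)\<^sup>*"
    using assms(2) sym_rtrancl[OF sym_avoiding] by (auto simp: parent_def dest: symD)
  with assms(3) have "(y, y') \<in> (avoiding G v)\<^sup>*"
    by (auto simp: parent_def)
  moreover have "(y, v) \<in> parcs G" "(y', v) \<in> parcs G"
    using assms(2,3) by (auto simp: parent_def)
  ultimately show False
    using neighbours_avoiding_imp_cycle neq assms(1) by blast
qed

text \<open>A walk from the root to \<open>u\<close> meets one end of the edge first; that end is
  the parent of the other.\<close>

lemma arc_imp_parent:
  assumes "(r, u) \<in> (parcs G)\<^sup>*" "(u, w) \<in> parcs G"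
  shows "parent G r u w \<or> parent G r w u"
proof (cases "r = u \<or> r = w")
  case True
  then show ?thesis
    using assms(2) arcs_symmetric[OF assms(2)] no_loops'[OF assms(2)] by (auto simp: parent_def)
next
  case False
  define A where "A = avoiding G u \<inter> avoiding G w"
  have sub: "A\<^sup>* \<subseteq> (avoiding G u)\<^sup>*" "A\<^sup>* \<subseteq> (avoiding G w)\<^sup>*"
    unfolding A_def by (auto intro!: rtrancl_mono)
  have "u \<noteq> w" using assms(2) no_loops' by blast
  \<comment> \<open>The last two alternatives do not mention \<open>z\<close>, so they persist once
    an end has been met. At \<open>z = u\<close> the first one is impossible.\<close>
  have "(r, z) \<in> A\<^sup>* \<and> z \<noteq> u \<and> z \<noteq> w \<or> (r, w) \<in> (avoiding G u)\<^sup>* \<or> (r, u) \<in> (avoiding G w)\<^sup>*"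
    if "(r, z) \<in> (parcs G)\<^sup>*" for z
    using that
  proof (induction rule: rtrancl_induct)
    case base
    then show ?case using False by blast
  next
    case (step y z)
    show ?case
    proof (cases "(r, y) \<in> A\<^sup>* \<and> y \<noteq> u \<and> y \<noteq> w")
      case True
      have "(y, z) \<in> A" if "z \<noteq> u" "z \<noteq> w"
        using that True step(2) by (auto simp: A_def avoiding_def)
      moreover have "(y, z) \<in> avoiding G w" if "z = u"
        using that True step(2) \<open>u \<noteq> w\<close> by (auto simp: avoiding_def)
      moreover have "(y, z) \<in> avoiding G u" if "z = w"
        using that True step(2) \<open>u \<noteq> w\<close> by (auto simp: avoiding_def)
      moreover have "(r, y) \<in> A\<^sup>*" "(r, y) \<in> (avoiding G u)\<^sup>*" "(r, y) \<in> (avoiding G w)\<^sup>*"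
        using True sub by auto
      ultimately show ?thesis
        by (blast intro: rtrancl_into_rtrancl)
    qed (use step.IH in blast)
  qed
  from this[OF assms(1)] show ?thesis
    using False assms(2) arcs_symmetric[OF assms(2)] by (auto simp: parent_def)
qed

lemma closed_nbhd_parent:
  assumes "(r, v) \<in> (parcs G)\<^sup>*"
  shows "closed_nbhd G v = insert v ({w. parent G r v w} \<union> {w. parent G r w v})"
  using arc_imp_parent[OF assms] by (auto simp: closed_nbhd_def parent_def dest: arcs_symmetric)

end

text \<open>The counting is done for an abstract \<open>par\<close>; the tree enters through the
  shape of closed neighbourhoods and the uniqueness and irreflexivity of parents.\<close>

lemma four_vertices_below_top:
  fixes par :: "'a \<Rightarrow> 'a \<Rightarrow> bool" and S :: "'a set"
  defines "C \<equiv> (\<lambda>x. {y \<in> S. par x y})"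
  assumes S: "redundant_identifying_code G S" "finite S"
    and nbhd: "\<And>v. v \<in> S \<Longrightarrow> closed_nbhd G v = insert v ({w. par v w} \<union> {w. par w v})"
    and uniq: "\<And>y y' v. par y v \<Longrightarrow> par y' v \<Longrightarrow> y = y'"
    and irrefl: "\<And>v. \<not> par v v"
    and x: "x \<in> S" "\<And>y. y \<in> S \<Longrightarrow> \<not> par y x"
  shows "card (insert x (C x \<union> (\<Union>y\<in>C x. C y))) \<ge> 4"
proof -
  have fin: "finite (C y)" for y using S(2) by (simp add: C_def)
  have SV: "S \<subseteq> pverts G" using S(1) by (simp add: redundant_identifying_code_def)
  have Nx: "closed_nbhd G x \<inter> S = insert x (C x)"
    using x by (auto simp: nbhd C_def)
  have "card (insert x (C x)) \<ge> 2"
    using S(1) SV x(1) Nx by (metis redundant_identifying_code_def subsetD)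
  then have "C x \<noteq> {}" by auto
  then obtain y where y: "y \<in> S" "par x y" by (auto simp: C_def)
  have "x \<noteq> y" using y irrefl by blast
  have Ny: "closed_nbhd G y \<inter> S = insert x (insert y (C y))"
    using x y uniq by (auto simp: nbhd C_def)
  \<comment> \<open>Both \<open>x\<close> and \<open>y\<close> lie in both neighbourhoods and
    cancel.\<close>
  have "sym_diff (closed_nbhd G x \<inter> S) (closed_nbhd G y \<inter> S) = (C x - {y}) \<union> C y"
    using x y \<open>x \<noteq> y\<close> irrefl uniq unfolding Nx Ny by (auto simp: C_def)
  moreover have "card (sym_diff (closed_nbhd G x \<inter> S) (closed_nbhd G y \<inter> S)) \<ge> 2"
    using S(1) SV x(1) y(1) \<open>x \<noteq> y\<close> unfolding redundant_identifying_code_def by blast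
  ultimately have "card ((C x - {y}) \<union> C y) \<ge> 2" by simp
  moreover have "x \<notin> (C x - {y}) \<union> C y" "y \<notin> (C x - {y}) \<union> C y"
    using x y irrefl by (auto simp: C_def)
  ultimately have "card (insert x (insert y ((C x - {y}) \<union> C y))) \<ge> 4"
    using fin \<open>x \<noteq> y\<close> by simp
  also have "\<dots> \<le> card (insert x (C x \<union> (\<Union>y\<in>C x. C y)))"
    by (rule card_mono) (use fin y in \<open>auto simp: C_def\<close>)
  finally show ?thesis .
qed

lemma redundant_identifying_code_card_rooted:
  fixes par :: "'a \<Rightarrow> 'a \<Rightarrow> bool"
  assumes S: "redundant_identifying_code G S" and V: "finite (pverts G)"
    and nbhd: "\<And>v. v \<in> pverts G \<Longrightarrow> closed_nbhd G v = insert v ({w. par v w} \<union> {w. par w v})"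
    and uniq: "\<And>y y' v. par y v \<Longrightarrow> par y' v \<Longrightarrow> y = y'"
    and irrefl: "\<And>v. \<not> par v v"
    and r: "r \<in> S" "\<And>y. \<not> par y r"
  shows "4 * (card (pverts G - S) + 1) \<le> card S"
proof -
  define U where "U = pverts G - S"
  define R where "R = {x \<in> S. \<forall>y\<in>S. \<not> par y x}"
  define C where "C = (\<lambda>x. {y \<in> S. par x y})"
  \<comment> \<open>Two levels below a top already contain four vertices, and keep the disjointness
    argument a finite case check.\<close>
  define B where "B = (\<lambda>x. insert x (C x \<union> (\<Union>y\<in>C x. C y)))"
  have SV: "S \<subseteq> pverts G" using S by (simp add: redundant_identifying_code_def)
  then have fS: "finite S" using V finite_subset by blast
  have fR: "finite R" using fS by (simp add: R_def)
  have "\<exists>c\<in>S. par u c" if "u \<in> U" for u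
  proof (rule ccontr)
    assume no: "\<not> (\<exists>c\<in>S. par u c)"
    have "closed_nbhd G u \<inter> S \<subseteq> {w. par w u}"
      using nbhd[of u] that no by (auto simp: U_def)
    \<comment> \<open>If \<open>u\<close> has no parent, the left side is empty and the value of
      \<open>THE\<close> is irrelevant.\<close>
    then have "closed_nbhd G u \<inter> S \<subseteq> {THE w. par w u}"
      using uniq by (auto intro!: the_equality[symmetric])
    then have "card (closed_nbhd G u \<inter> S) \<le> card {THE w. par w u}"
      by (intro card_mono) auto
    moreover have "card (closed_nbhd G u \<inter> S) \<ge> 2"
      using S that by (auto simp: redundant_identifying_code_def U_def)
    ultimately show False by simp
  qed
  then obtain f where f: "\<And>u. u \<in> U \<Longrightarrow> f u \<in> S \<and> par u (f u)" by metis
  have inj: "inj_on f U" using f uniq by (metis inj_onI)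
  have "r \<notin> f ` U" using f r by auto
  \<comment> \<open>The only parent of \<open>f u\<close> is \<open>u\<close>, which lies outside
    \<open>S\<close>.\<close>
  have "insert r (f ` U) \<subseteq> R"
    using f r uniq unfolding R_def U_def by blast
  then have "card (insert r (f ` U)) \<le> card R" using fR by (rule card_mono[rotated])
  moreover have "card (insert r (f ` U)) = card U + 1"
    using \<open>r \<notin> f ` U\<close> V inj by (simp add: U_def card_image)
  ultimately have UR: "card U + 1 \<le> card R" by simp
  have "card (B x) \<ge> 4" if "x \<in> R" for x
    unfolding B_def C_def
    by (rule four_vertices_below_top[OF S fS])
       (use that nbhd SV uniq irrefl in \<open>auto simp: R_def\<close>)
  then have "card R * 4 \<le> (\<Sum>x\<in>R. card (B x))"
    using sum_bounded_below[of R 4 "\<lambda>x. card (B x)"] by simp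
  also have "\<dots> = card (\<Union>x\<in>R. B x)"
  proof (rule card_UN_disjoint[symmetric, OF fR])
    show "\<forall>x\<in>R. finite (B x)" using fS by (simp add: B_def C_def)
    show "\<forall>x\<in>R. \<forall>x'\<in>R. x \<noteq> x' \<longrightarrow> B x \<inter> B x' = {}"
    proof (intro ballI impI equals0I)
      fix x x' v
      assume x: "x \<in> R" "x' \<in> R" "x \<noteq> x'" and v: "v \<in> B x \<inter> B x'"
      have cases: "v = z \<or> par z v \<or> (\<exists>y\<in>S. par z y \<and> par y v)" if "v \<in> B z" for z
        using that by (auto simp: B_def C_def)
      have top: "\<not> par y z" if "z \<in> R" "y \<in> S" for y z
        using that by (auto simp: R_def)
      have RS: "x \<in> S" "x' \<in> S" using x by (auto simp: R_def)
      \<comment> \<open>Climbing from \<open>v\<close> along unique parents in \<open>S\<close>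
        reaches both \<open>x\<close> and \<open>x'\<close>. Neither has a parent in
        \<open>S\<close>, so the climb stops at the same vertex.\<close>
      show False
        using cases[of x] cases[of x'] v x(3) top[OF x(1)] top[OF x(2)] RS uniq by (metis IntE)
    qed
  qed
  also have "\<dots> \<le> card S"
    by (rule card_mono[OF fS]) (auto simp: B_def C_def R_def)
  finally show ?thesis using UR by (simp add: U_def)
qed

lemma redundant_identifying_code_card_ge:
  assumes T: "undirected_tree T" and S: "redundant_identifying_code T S"
  shows "4 * (card (pverts T) + 1) \<le> 5 * card S"
proof -
  interpret pair_graph T using T by (simp add: undirected_tree_def)
  have acyc: "\<nexists>p. cycle p \<and> length p \<ge> 3"
    using T by (simp add: undirected_tree_def)
  have sc: "strongly_connected (with_proj T)"
    using T by (auto simp: undirected_tree_def intro: symmetric_connected_imp_strongly_connected)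
  then have ne: "pverts T \<noteq> {}" by (simp add: strongly_connected_def)
  have reach: "(u, v) \<in> (parcs T)\<^sup>*" if "u \<in> pverts T" "v \<in> pverts T" for u v
    using sc that reachable_rtranclI[of "with_proj T" u v] by (simp add: strongly_connected_def)
  have SV: "S \<subseteq> pverts T" using S by (simp add: redundant_identifying_code_def)
  have "S \<noteq> {}" using S ne by (auto simp: redundant_identifying_code_def)
  then obtain r where r: "r \<in> S" by blast
  have "4 * (card (pverts T - S) + 1) \<le> card S"
  proof (rule redundant_identifying_code_card_rooted[OF S pair_finite_verts, where par = "parent T r"])
    show "closed_nbhd T v = insert v ({w. parent T r v w} \<union> {w. parent T r w v})"
      if "v \<in> pverts T" for v
      using closed_nbhd_parent reach r SV that by blast
    show "y = y'" if "parent T r y v" "parent T r y' v" for y y' v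
      using parent_unique[OF acyc that] .
    show "\<not> parent T r v v" for v using no_loops' by (auto simp: parent_def)
  qed (use r in \<open>auto simp: parent_def\<close>)
  \<comment> \<open>Adding \<open>4 * card S\<close> to both sides of the rooted bound gives the
    claim.\<close>
  moreover have "card (pverts T) = card (pverts T - S) + card S"
    using SV card_Diff_subset[OF finite_subset[OF SV pair_finite_verts] SV]
      card_mono[OF pair_finite_verts SV] by simp
  ultimately show ?thesis by simp
qed

theorem theorem7:
  fixes T :: "'a pair_pre_digraph" and n :: nat
  assumes "undirected_tree T"
    and "n = card (pverts T)"
    and "n \<ge> 4"
    and "\<exists>S. redundant_identifying_code T S"
  shows "\<lceil>(4 / 5 :: real) * (real n + 1)\<rceil> \<le> int (RED_IC T) \<and> RED_IC T \<le> n"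
proof -
  have "\<exists>k S. redundant_identifying_code T S \<and> card S = k" using assms(4) by blast
  then have "\<exists>S. redundant_identifying_code T S \<and> card S = RED_IC T"
    unfolding RED_IC_def by (rule LeastI_ex)
  then obtain S where S: "redundant_identifying_code T S" "card S = RED_IC T" by blast
  have "4 * (n + 1) \<le> 5 * RED_IC T"
    using redundant_identifying_code_card_ge[OF assms(1) S(1)] S(2) assms(2) by simp
  then have "real (4 * (n + 1)) \<le> real (5 * RED_IC T)" by (rule of_nat_mono)
  then have "\<lceil>(4 / 5 :: real) * (real n + 1)\<rceil> \<le> int (RED_IC T)"
    by (intro ceiling_le) simp
  \<comment> \<open>An infinite set has \<open>card\<close> 0, which is below 4.\<close>
  moreover have "finite (pverts T)"
    using assms(3) unfolding assms(2) by (metis card.infinite not_numeral_le_zero)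
  then have "RED_IC T \<le> n"
    using card_mono[of "pverts T" S] S assms(2) by (simp add: redundant_identifying_code_def)
  ultimately show ?thesis by blast
qed

end
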